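(* Let $p$ be a prime, $G$ a finite additive abelian $p$-group, and $h,\Delta\in\{0,1,2,\ldots\}$. Let $A=\{a_s(n_s)\}_{s=1}^k$ (with $a_s\in\mathbb Z$, $n_s\in\mathbb Z^+$) be a $(d^*(G)+p^h+\Delta)$-cover of $\mathbb Z$. Let $m_1,\ldots,m_k\in\mathbb Z$, $c,c_1,\ldots,c_k\in G$ and $\alpha\in\mathbb Q$, and set $$\mathcal I=\Big\{I\subseteq\{1,\ldots,k\}:\ \sum_{s\in I}c_s=c\ \text{and}\ \sum_{s\in I}\frac{m_s}{n_s}\in\alpha+p^h\mathbb Z\Big\}.$$ For $I\subseteq\{1,\ldots,k\}$ write $P(I)=P([\![1\in I]\!],\ldots,[\![k\in I]\!])$. Let $d\in\mathbb Z^+$ and let $P(x_1,\ldots,x_k)\in\mathbb Q[x_1,\ldots,x_k]$ have degree at most $d$, such that $P(I)\in\mathbb Z$ for every $I\subseteq\{1,\ldots,k\}$ with $\sum_{s\in I}m_s/n_s-\alpha\in\mathbb Z$. Then either $$\big|\{P(I)\bmod p:\ I\in\mathcal I\}\big|>1+\frac{\Delta}{d},$$ or both $|\{I\in\mathcal I: p\mid P(I)\}|\ne 1$ and $$\sum_{\substack{I\in\mathcal I\\ p\mid P(I)}}(-1)^{|I|}e^{2\pi i\sum_{s\in I}a_sm_s/n_s}\equiv 0\pmod p,$$ where the last congruence is in the ring $\Omega$ of algebraic integers (i.e., the left side lies in $p\Omega$).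
   Context: $[\![P]\!]$ denotes $1$ if the statement $P$ holds and $0$ otherwise. For $a\in\mathbb Z$ and $n\in\mathbb Z^+$, $a(n)=a+n\mathbb Z$. For $A=\{a_s(n_s)\}_{s=1}^k$, $w_A(x)=|\{1\le s\le k: x\in a_s(n_s)\}|$; $A$ is an $m$-cover of $\mathbb Z$ if $w_A(x)\ge m$ for all $x\in\mathbb Z$. For a finite abelian group $G$ with $|G|>1$, write $G\cong\mathbb Z_{d_1}\oplus\cdots\oplus\mathbb Z_{d_r}$ with $1<d_1\mid d_2\mid\cdots\mid d_r$ and set $d^*(G)=\sum_{i=1}^r(d_i-1)$; if $|G|=1$ set $d^*(G)=0$. For algebraic integers $\omega_1,\omega_2,\gamma$, $\omega_1\equiv\omega_2\pmod\gamma$ means $\omega_1-\omega_2\in\gamma\Omega$. *)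

theory Defs
  imports Complex_Main "HOL-Algebra.FiniteProduct" "HOL-Algebra.Product_Groups"
    "HOL-Library.Poly_Mapping"
    "HOL-Computational_Algebra.Polynomial"
begin

section \<open>Covers of the integers by residue classes\<close>

definition residue_class :: "int \<Rightarrow> nat \<Rightarrow> int set"
  where "residue_class a n = {a + int n * z | z. True}"

definition cover_mult :: "nat \<Rightarrow> (nat \<Rightarrow> int) \<Rightarrow> (nat \<Rightarrow> nat) \<Rightarrow> int \<Rightarrow> nat"
  where "cover_mult k a n x = card {s \<in> {1..k}. x \<in> residue_class (a s) (n s)}"

definition is_m_cover :: "nat \<Rightarrow> nat \<Rightarrow> (nat \<Rightarrow> int) \<Rightarrow> (nat \<Rightarrow> nat) \<Rightarrow> bool"
  where "is_m_cover m k a n \<longleftrightarrow> (\<forall>x. cover_mult k a n x \<ge> m)"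


section \<open>Finite abelian groups\<close>

text \<open>
  Groups are those of HOL-Algebra, so the additive group of the text is written multiplicatively;
  the sum of a family of elements is \<^const>\<open>finprod\<close>.
\<close>

definition invariant_factors :: "('g, 'b) monoid_scheme \<Rightarrow> nat list \<Rightarrow> bool"
  where "invariant_factors G ds \<longleftrightarrow>
    (\<forall>d \<in> set ds. 1 < d) \<and> sorted_wrt (dvd) ds \<and>
    G \<cong> product_group {..<length ds} (\<lambda>i. integer_mod_group (ds ! i))"

text \<open>
  By the structure theorem a finite abelian group has exactly one list of invariant factors,
  so the choice below is no choice.
\<close>

definition dstar :: "('g, 'b) monoid_scheme \<Rightarrow> nat"
  where "dstar G =
    (if Coset.order G = 1 then 0
     else \<Sum>d\<leftarrow>(SOME ds. invariant_factors G ds). d - 1)"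

definition is_p_group :: "nat \<Rightarrow> ('g, 'b) monoid_scheme \<Rightarrow> bool"
  where "is_p_group p G \<longleftrightarrow> group G \<and> (\<exists>e. Coset.order G = p ^ e)"


section \<open>Multivariate polynomials\<close>

text \<open>
  A polynomial maps finitely many monomials to nonzero coefficients; a monomial maps finitely many
  variable indices to nonzero exponents.
\<close>

type_synonym 'a mvpoly = "(nat \<Rightarrow>\<^sub>0 nat) \<Rightarrow>\<^sub>0 'a"

definition mv_vars :: "'a::zero mvpoly \<Rightarrow> nat set"
  where "mv_vars P = (\<Union>t \<in> Poly_Mapping.keys P. Poly_Mapping.keys t)"

text \<open>The zero polynomial gets degree 0.\<close>

definition mv_degree :: "'a::zero mvpoly \<Rightarrow> nat"
  where "mv_degree P = Max (insert 0 ((\<lambda>t. \<Sum>i \<in> Poly_Mapping.keys t. Poly_Mapping.lookup t i) ` Poly_Mapping.keys P))"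

definition mv_eval :: "'a::comm_semiring_1 mvpoly \<Rightarrow> (nat \<Rightarrow> 'a) \<Rightarrow> 'a"
  where "mv_eval P x = (\<Sum>t \<in> Poly_Mapping.keys P. Poly_Mapping.lookup P t * (\<Prod>i \<in> Poly_Mapping.keys t. x i ^ Poly_Mapping.lookup t i))"

definition eval_at_set :: "'a::comm_semiring_1 mvpoly \<Rightarrow> nat set \<Rightarrow> 'a"
  where "eval_at_set P I = mv_eval P (\<lambda>s. of_bool (s \<in> I))"


section \<open>Congruence of algebraic integers\<close>

definition alg_int_cong :: "complex \<Rightarrow> complex \<Rightarrow> complex \<Rightarrow> bool"
  where "alg_int_cong w1 w2 g \<longleftrightarrow> (\<exists>w. algebraic_int w \<and> w1 - w2 = g * w)"

end

theory Submission
  imports Defs "HOL-Algebra.Multiplicative_Group" "HOL-Algebra.Generated_Groups"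
    "HOL-Number_Theory.Cong" "Jordan_Normal_Form.Char_Poly"
begin

text \<open>
  Write \<open>e(x) = exp(2\<pi>ix)\<close>. For an integer \<open>x\<close>, the product of the factors
  \<open>1 - e((a\<^sub>s - x) m\<^sub>s / n\<^sub>s) y\<^sub>s\<close> has more than \<open>D\<close> factors \<open>1 - y\<^sub>s\<close> when the
  residue classes cover \<open>x\<close> more than \<open>D\<close> times; hence the alternating sum over all \<open>I\<close> of
  \<open>e(\<Sum>\<^sub>I (a\<^sub>s - x) m\<^sub>s / n\<^sub>s) F(I)\<close> vanishes for every polynomial \<open>F\<close> of degree at most \<open>D\<close>.
  Averaging over \<open>x\<close> against \<open>e(x\<alpha>)\<close> isolates the \<open>I\<close> with
  \<open>\<Sum>\<^sub>I m\<^sub>s / n\<^sub>s - \<alpha>\<close> integral. If \<open>P\<close> takes few residues on the family, then the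
  condition defining the family, together with \<open>p | P(I)\<close>, is expressed modulo \<open>p\<close> by a polynomial
  \<open>F\<close> of small degree, built from the factors \<open>P(I) - \<rho>\<close> for the nonzero residues \<open>\<rho>\<close> and from
  binomial coefficients \<open>binom(x - 1, p\<^sup>t - 1)\<close>, which are divisible by \<open>p\<close> unless \<open>p\<^sup>t | x\<close>:
  one with \<open>t = h\<close>, and one for each invariant factor of \<open>G\<close>, of total degree \<open>d*(G)\<close>.
\<close>

section \<open>Polynomial functions of a set\<close>

text \<open>At 0/1 points every power of a variable equals the variable, so only squarefree
  monomials matter, and such a monomial takes the value \<open>of_bool (T \<subseteq> I)\<close> at
  \<open>I\<close>. Generating functions rather than formal polynomials gives induction on monomials
  directly.\<close>

inductive set_poly :: "nat \<Rightarrow> ('i set \<Rightarrow> 'a::comm_ring_1) \<Rightarrow> bool" for D where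
  monomial: "finite T \<Longrightarrow> card T \<le> D \<Longrightarrow> set_poly D (\<lambda>I. r * of_bool (T \<subseteq> I))"
| add: "set_poly D f \<Longrightarrow> set_poly D g \<Longrightarrow> set_poly D (\<lambda>I. f I + g I)"

lemma set_poly_mono: "set_poly D f \<Longrightarrow> D \<le> E \<Longrightarrow> set_poly E f"
  by (induction rule: set_poly.induct) (auto intro: set_poly.intros)

lemma set_poly_const: "set_poly D (\<lambda>I. r)"
  using set_poly.monomial[of "{}" D r] by simp

lemma set_poly_sum:
  assumes "\<And>x. x \<in> A \<Longrightarrow> set_poly D (f x)"
  shows "set_poly D (\<lambda>I. \<Sum>x\<in>A. f x I)"
  using assms
  by (induction A rule: infinite_finite_induct) (auto intro: set_poly_const set_poly.add)

lemma set_poly_mult: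
  assumes "set_poly D f" "set_poly E g"
  shows "set_poly (D + E) (\<lambda>I. f I * g I)"
  using assms(1)
proof induction
  case (monomial T r)
  show ?case using assms(2)
  proof induction
    case (monomial T' r')
    have "set_poly (D + E) (\<lambda>I. (r * r') * of_bool (T \<union> T' \<subseteq> I))"
      using monomial \<open>finite T\<close> \<open>card T \<le> D\<close>
      by (intro set_poly.monomial) (auto intro: order_trans[OF card_Un_le] add_mono)
    then show ?case by (simp add: of_bool_conj mult_ac)
  next
    case (add f g)
    from set_poly.add[OF add.IH] show ?case by (simp only: distrib_left)
  qed
next
  case (add f g)
  from set_poly.add[OF add.IH] show ?case by (simp only: distrib_right)
qed

lemma set_poly_prod:
  assumes "\<And>x. x \<in> A \<Longrightarrow> set_poly (D x) (f x)"
  shows "set_poly (\<Sum>x\<in>A. D x) (\<lambda>I. \<Prod>x\<in>A. f x I)"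
  using assms
  by (induction A rule: infinite_finite_induct) (auto intro: set_poly_const set_poly_mult)

lemma set_poly_linear:
  assumes "finite U"
  shows "set_poly (Suc 0) (\<lambda>I. (\<Sum>s\<in>U \<inter> I. w s) + r)"
proof -
  have "set_poly (Suc 0) (\<lambda>I. (\<Sum>s\<in>U. w s * of_bool ({s} \<subseteq> I)) + r)"
    by (intro set_poly.add set_poly_const set_poly_sum set_poly.monomial) auto
  also have "(\<lambda>I. (\<Sum>s\<in>U. w s * of_bool ({s} \<subseteq> I)) + r) = (\<lambda>I. (\<Sum>s\<in>U \<inter> I. w s) + r)"
    by (rule ext) (simp add: sum.inter_restrict[OF assms] of_bool_def if_distrib cong: if_cong)
  finally show ?thesis .
qed

text \<open>The binomial coefficient is a product of \<open>j\<close> factors \<open>f I - i\<close>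
  divided by \<open>fact j\<close>; the division is where characteristic 0 enters.\<close>

lemma set_poly_gchoose:
  fixes f :: "'i set \<Rightarrow> 'a::field_char_0"
  assumes "set_poly (Suc 0) f"
  shows "set_poly j (\<lambda>I. f I gchoose j)"
proof -
  have "set_poly (\<Sum>i\<in>{0..<j}. Suc 0) (\<lambda>I. \<Prod>i\<in>{0..<j}. f I + (- of_nat i))"
    by (intro set_poly_prod set_poly.add set_poly_const assms)
  from set_poly_mult[OF this set_poly_const[of 0 "1 / fact j"]]
  show ?thesis by (simp add: gbinomial_prod_rev)
qed

text \<open>At a 0/1 point a monomial depends only on its support, and the support has at most as
  many elements as the degree because each exponent there is at least 1.\<close>

lemma set_poly_eval_at_set: "set_poly (mv_degree P) (eval_at_set P)"
proof -
  have "set_poly (mv_degree P)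
    (\<lambda>I. \<Sum>t\<in>Poly_Mapping.keys P. Poly_Mapping.lookup P t * of_bool (Poly_Mapping.keys t \<subseteq> I))"
  proof (intro set_poly_sum set_poly.monomial)
    fix t assume t: "t \<in> Poly_Mapping.keys P"
    have "card (Poly_Mapping.keys t) = (\<Sum>i\<in>Poly_Mapping.keys t. 1)" by simp
    also have "\<dots> \<le> (\<Sum>i\<in>Poly_Mapping.keys t. Poly_Mapping.lookup t i)"
      by (intro sum_mono) (simp add: Suc_le_eq in_keys_iff)
    also have "\<dots> \<le> mv_degree P" unfolding mv_degree_def using t by (intro Max_ge) auto
    finally show "card (Poly_Mapping.keys t) \<le> mv_degree P" .
  qed auto
  also have "(\<lambda>I. \<Sum>t\<in>Poly_Mapping.keys P. Poly_Mapping.lookup P t * of_bool (Poly_Mapping.keys t \<subseteq> I))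
      = eval_at_set P"
  proof (rule ext)
    fix I :: "nat set"
    have "(\<Prod>i\<in>Poly_Mapping.keys t. of_bool (i \<in> I) ^ Poly_Mapping.lookup t i) =
        (of_bool (Poly_Mapping.keys t \<subseteq> I) :: 'a)" for t
    proof (cases "Poly_Mapping.keys t \<subseteq> I")
      case True
      then show ?thesis by (auto intro!: prod.neutral)
    next
      case False
      then obtain i where "i \<in> Poly_Mapping.keys t" "i \<notin> I" by auto
      then show ?thesis using False
        by (intro trans[OF prod_zero]) (auto intro!: bexI[of _ i] simp: in_keys_iff power_0_left)
    qed
    then show "(\<Sum>t\<in>Poly_Mapping.keys P. Poly_Mapping.lookup P t * of_bool (Poly_Mapping.keys t \<subseteq> I))
        = eval_at_set P I"
      by (simp add: eval_at_set_def mv_eval_def)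
  qed
  finally show ?thesis .
qed

lemma set_poly_of_rat:
  assumes "set_poly D f"
  shows "set_poly D (\<lambda>I. of_rat (f I) :: 'a::field_char_0)"
  using assms
proof induction
  case (monomial T r)
  have "(\<lambda>I. of_rat (r * of_bool (T \<subseteq> I))) = (\<lambda>I. (of_rat r :: 'a) * of_bool (T \<subseteq> I))"
    by (auto simp: of_rat_mult)
  then show ?case using monomial by (auto intro: set_poly.monomial)
next
  case (add f g)
  then show ?case by (simp add: of_rat_add set_poly.add)
qed

text \<open>For a monomial the sum factors as a product over \<^term>\<open>U\<close>, and some \<^prop>\<open>w s = -1\<close>
  outside the monomial gives a zero factor.\<close>

lemma set_poly_weighted_sum_eq_0:
  fixes w :: "'i \<Rightarrow> 'a::comm_ring_1"
  assumes "set_poly D f" "finite U" "D < card {s \<in> U. w s = -1}"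
  shows "(\<Sum>I\<in>Pow U. (\<Prod>s\<in>I. w s) * f I) = 0"
  using assms(1)
proof induction
  case (monomial T r)
  have "\<not> {s \<in> U. w s = -1} \<subseteq> T"
    using monomial assms(2,3) card_mono[of T "{s \<in> U. w s = -1}"] by force
  then obtain s where s: "s \<in> U" "w s = -1" "s \<notin> T" by auto
  show ?case
  proof (cases "T \<subseteq> U")
    case True
    \<comment> \<open>Spreading the condition \<open>T \<subseteq> I\<close> over the elements of
      \<open>U - I\<close> turns the sum over subsets into the expansion of a product over
      \<open>U\<close>.\<close>
    have "(\<Prod>s\<in>U - I. of_bool (s \<notin> T)) = (of_bool (T \<subseteq> I) :: 'a)" if "I \<subseteq> U" for I
    proof (cases "T \<subseteq> I")
      case True
      then show ?thesis by (auto intro!: prod.neutral)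
    next
      case False
      then obtain t where "t \<in> T" "t \<notin> I" by auto
      then show ?thesis using False \<open>T \<subseteq> U\<close> assms(2)
        by (auto intro!: prod_zero bexI[of _ t])
    qed
    then have "(\<Sum>I\<in>Pow U. (\<Prod>s\<in>I. w s) * of_bool (T \<subseteq> I)) =
        (\<Sum>I\<in>Pow U. (\<Prod>s\<in>I. w s) * (\<Prod>s\<in>U - I. of_bool (s \<notin> T)))"
      by (intro sum.cong) auto
    also have "\<dots> = (\<Prod>s\<in>U. w s + of_bool (s \<notin> T))"
      using assms(2) by (simp add: prod_add)
    also have "\<dots> = 0"
      using s assms(2) by (intro prod_zero bexI[of _ s]) auto
    finally have "(\<Sum>I\<in>Pow U. (\<Prod>s\<in>I. w s) * of_bool (T \<subseteq> I)) = 0" .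
    then have "r * (\<Sum>I\<in>Pow U. (\<Prod>s\<in>I. w s) * of_bool (T \<subseteq> I)) = 0" by simp
    then show ?thesis by (simp add: sum_distrib_left mult_ac)
  next
    case False
    then show ?thesis by (intro sum.neutral) auto
  qed
next
  case (add f g)
  then show ?case by (simp add: distrib_left sum.distrib)
qed

section \<open>Binomial coefficients modulo a prime\<close>

text \<open>The upper argument may be negative. The rational coefficient is already an integer, so
  the floor only changes its type.\<close>

definition int_choose :: "int \<Rightarrow> nat \<Rightarrow> int"
  where "int_choose x j = \<lfloor>(of_int x :: rat) gchoose j\<rfloor>"

lemma of_int_int_choose: "of_int (int_choose x j) = (of_int x :: rat) gchoose j"
proof -
  have "\<exists>z. (of_int x :: rat) gchoose j = of_int z"
    by (rule exI, rule of_int_gbinomial[symmetric])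
  then show ?thesis by (auto simp: int_choose_def)
qed

lemma int_choose_0 [simp]: "int_choose x 0 = 1"
  by (simp add: int_choose_def)

lemma int_choose_Suc: "int_choose x (Suc j) = int_choose (x - 1) j + int_choose (x - 1) (Suc j)"
proof -
  have "(of_int (int_choose x (Suc j)) :: rat) = of_int (int_choose (x - 1) j + int_choose (x - 1) (Suc j))"
    using gbinomial_Suc_Suc[of "of_int x - 1 :: rat" j] by (simp add: of_int_int_choose)
  then show ?thesis by (simp only: of_int_eq_iff)
qed

lemma int_choose_absorption:
  assumes "j > 0"
  shows "int j * int_choose x j = x * int_choose (x - 1) (j - 1)"
proof -
  obtain i where j: "j = Suc i" using \<open>j > 0\<close> by (cases j) auto
  have "(of_int (int j * int_choose x j) :: rat) = of_int (x * int_choose (x - 1) (j - 1))"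
    using gbinomial_absorption[of i "of_int x :: rat"] by (simp add: of_int_int_choose j)
  then show ?thesis by (simp only: of_int_eq_iff)
qed

text \<open>Absorption gives that \<open>p ^ t\<close> divides
  \<open>x * int_choose (x - 1) (p ^ t - 1)\<close>. If the second factor were prime to
  \<open>p\<close>, all of \<open>p ^ t\<close> would divide \<open>x\<close>.\<close>

lemma prime_dvd_int_choose_of_not_dvd:
  assumes "prime p" "\<not> int (p ^ t) dvd x"
  shows "int p dvd int_choose (x - 1) (p ^ t - 1)"
proof (rule ccontr)
  assume "\<not> ?thesis"
  then have "coprime (int p ^ t) (int_choose (x - 1) (p ^ t - 1))"
    using assms(1) by (simp add: prime_imp_coprime)
  moreover have "int (p ^ t) dvd x * int_choose (x - 1) (p ^ t - 1)"
    using int_choose_absorption[of "p ^ t" x] assms(1) prime_gt_0_nat[of p]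
    by (metis dvd_triv_left zero_less_power)
  ultimately show False using assms(2) by (simp add: coprime_dvd_mult_left_iff)
qed

text \<open>Absorption again: \<open>p ^ t\<close> divides \<open>j * int_choose x j\<close>, but
  cannot divide \<open>j\<close> because of its size, so \<open>p\<close> must divide the other
  factor.\<close>

lemma prime_dvd_int_choose_of_dvd:
  assumes "prime p" "int (p ^ t) dvd x" "0 < j" "j < p ^ t"
  shows "int p dvd int_choose x j"
proof (rule ccontr)
  assume "\<not> ?thesis"
  then have "coprime (int p ^ t) (int_choose x j)"
    using assms(1) by (simp add: prime_imp_coprime)
  moreover have "int (p ^ t) dvd int j * int_choose x j"
    using int_choose_absorption[of j x] assms by simp
  ultimately have "int (p ^ t) dvd int j" by (simp add: coprime_dvd_mult_left_iff)
  then show False using assms by (auto simp del: of_nat_power dest: dvd_imp_le)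
qed

text \<open>In Pascal's rule for \<open>int_choose x (Suc j)\<close> the left side vanishes modulo
  \<open>p\<close>, so each step of the induction flips the sign.\<close>

lemma int_choose_pred_cong:
  assumes "prime p" "int (p ^ t) dvd x" "j < p ^ t"
  shows "int p dvd int_choose (x - 1) j - (-1) ^ j"
  using assms(3)
proof (induction j)
  case (Suc j)
  have "int p dvd int_choose x (Suc j)"
    using prime_dvd_int_choose_of_dvd[OF assms(1,2)] Suc.prems by simp
  moreover have "int p dvd int_choose (x - 1) j - (-1) ^ j" using Suc by simp
  ultimately have "int p dvd int_choose x (Suc j) - (int_choose (x - 1) j - (-1) ^ j)"
    by (rule dvd_diff)
  then show ?case by (simp add: int_choose_Suc[of x j])
qed simp

text \<open>The sign does not depend on \<open>x\<close>, so a polynomial of degree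
  \<open>p ^ t - 1\<close> serves as an indicator of divisibility by \<open>p ^ t\<close> modulo
  \<open>p\<close>, up to a constant unit.\<close>

lemma int_choose_prime_power_cong:
  assumes "prime p"
  shows "int p dvd int_choose (x - 1) (p ^ t - 1) - of_bool (int (p ^ t) dvd x) * (-1) ^ (p ^ t - 1)"
  using prime_dvd_int_choose_of_not_dvd[of p t x] int_choose_pred_cong[of p t x "p ^ t - 1"] assms
    prime_gt_0_nat[of p]
  by (cases "int (p ^ t) dvd x") auto

section \<open>Invariant factors of finite abelian p-groups\<close>

context comm_group
begin

lemma finprod_int_pow_add:
  assumes "S \<subseteq> carrier G"
  shows "(\<Otimes>s\<in>S. s [^] (x s + y s :: int)) = (\<Otimes>s\<in>S. s [^] x s) \<otimes> (\<Otimes>s\<in>S. s [^] y s)"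
proof -
  have "(\<Otimes>s\<in>S. s [^] (x s + y s)) = (\<Otimes>s\<in>S. s [^] x s \<otimes> s [^] y s)"
    using assms by (intro finprod_cong') (auto simp: int_pow_mult)
  also have "\<dots> = (\<Otimes>s\<in>S. s [^] x s) \<otimes> (\<Otimes>s\<in>S. s [^] y s)"
    using assms by (intro finprod_multf) auto
  finally show ?thesis .
qed

lemma finprod_int_pow_uminus:
  assumes "S \<subseteq> carrier G"
  shows "(\<Otimes>s\<in>S. s [^] (- x s :: int)) = inv (\<Otimes>s\<in>S. s [^] x s)"
proof (rule sym, rule inv_equality)
  show "(\<Otimes>s\<in>S. s [^] - x s) \<otimes> (\<Otimes>s\<in>S. s [^] x s) = \<one>"
    using finprod_int_pow_add[OF assms, of "\<lambda>s. - x s" x] by simp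
qed (use assms in \<open>auto intro!: finprod_closed\<close>)

lemma finprod_int_pow_pow:
  assumes "S \<subseteq> carrier G"
  shows "(\<Otimes>s\<in>S. s [^] (x s :: int)) [^] (n::int) = (\<Otimes>s\<in>S. s [^] (x s * n))"
  using assms
proof (induction S rule: infinite_finite_induct)
  case (insert s S)
  then have "(\<lambda>s. s [^] x s) \<in> S \<rightarrow> carrier G" "(\<lambda>s. s [^] (x s * n)) \<in> S \<rightarrow> carrier G" by auto
  with insert show ?case
    by (simp add: int_pow_distrib int_pow_pow finprod_closed)
qed (auto simp: int_pow_one)

lemma subgroup_finprod_closed:
  assumes "subgroup H G" "\<And>s. s \<in> S \<Longrightarrow> f s \<in> H"
  shows "finprod G f S \<in> H"
  using assms(2)
proof (induction S rule: infinite_finite_induct)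
  case (insert s S)
  then have "f \<in> S \<rightarrow> carrier G" "f s \<in> carrier G"
    using subgroup.mem_carrier[OF assms(1)] by auto
  with insert show ?case by (simp add: subgroup.m_closed[OF assms(1)])
qed (auto simp: subgroup.one_closed[OF assms(1)])

text \<open>By commutativity the products on the right form a subgroup; it contains
  \<open>S\<close>, as indicator exponents show. This makes the map from exponent vectors onto the
  group surjective for a generating set.\<close>

lemma generate_finite_eq:
  assumes "finite S" "S \<subseteq> carrier G"
  shows "generate G S = range (\<lambda>x :: 'a \<Rightarrow> int. \<Otimes>s\<in>S. s [^] x s)"
proof
  let ?H = "range (\<lambda>x :: 'a \<Rightarrow> int. \<Otimes>s\<in>S. s [^] x s)"
  have "subgroup ?H G"
  proof (rule subgroupI)
    show "?H \<subseteq> carrier G" using assms by (auto intro!: finprod_closed)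
    fix a b assume "a \<in> ?H" "b \<in> ?H"
    then obtain x y where "a = (\<Otimes>s\<in>S. s [^] (x s :: int))" "b = (\<Otimes>s\<in>S. s [^] (y s :: int))" by auto
    then show "a \<otimes> b \<in> ?H"
      using finprod_int_pow_add[OF assms(2), of x y] by (auto intro!: image_eqI[of _ _ "\<lambda>s. x s + y s"])
  next
    fix a assume "a \<in> ?H"
    then obtain x where "a = (\<Otimes>s\<in>S. s [^] (x s :: int))" by auto
    then show "inv a \<in> ?H"
      using finprod_int_pow_uminus[OF assms(2), of x] by (auto intro!: image_eqI[of _ _ "\<lambda>s. - x s"])
  qed auto
  moreover have "S \<subseteq> ?H"
  proof
    fix t assume t: "t \<in> S"
    have "(\<Otimes>s\<in>S. s [^] (of_bool (t = s) :: int)) = (\<Otimes>s\<in>S. if t = s then id s else \<one>)"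
      using assms by (intro finprod_cong') auto
    also have "\<dots> = t" using finprod_singleton[of t S id] t assms by (auto simp: Pi_iff)
    finally show "t \<in> ?H" by (intro image_eqI[of t _ "\<lambda>s. of_bool (t = s)"]) simp_all
  qed
  ultimately show "generate G S \<subseteq> ?H" by (intro generate_subgroup_incl)
next
  have gen: "subgroup (generate G S) G" using assms by (intro generate_is_subgroup)
  show "range (\<lambda>x :: 'a \<Rightarrow> int. \<Otimes>s\<in>S. s [^] x s) \<subseteq> generate G S"
  proof clarify
    fix x :: "'a \<Rightarrow> int"
    show "(\<Otimes>s\<in>S. s [^] x s) \<in> generate G S"
      by (intro subgroup_finprod_closed[OF gen] subgroup_int_pow_closed[OF gen] generate.incl)
  qed
qed

text \<open>Given a nontrivial relation among generators of a finite abelian \<open>p\<close>-group, extract the highest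
  common power \<open>p ^ v\<close> of the exponents of its nontrivial factors. The generator \<open>g\<close> attaining that
  power may be replaced by the product \<open>g'\<close> of the generators raised to the reduced exponents,
  and \<open>g' ^ (p ^ v) = 1\<close> while \<open>g\<close> has larger order.\<close>

lemma p_group_generators_exchange:
  assumes fin: "finite (carrier G)" and p: "prime p" and ord: "Coset.order G = p ^ e"
    and S: "S \<subseteq> carrier G" "generate G S = carrier G"
    and rel: "(\<Otimes>s\<in>S. s [^] (x s :: int)) = \<one>" and nontriv: "\<exists>s\<in>S. s [^] x s \<noteq> \<one>"
  shows "\<exists>S'. S' \<subseteq> carrier G \<and> generate G S' = carrier G \<and> (\<Sum>s\<in>S'. ord s) < (\<Sum>s\<in>S. ord s)"
proof -
  have finS: "finite S" using S(1) fin by (rule finite_subset)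
  define T where "T = {s \<in> S. s [^] x s \<noteq> \<one>}"
  have T: "finite T" "T \<noteq> {}" using finS nontriv by (auto simp: T_def)
  define v where "v = Min ((\<lambda>s. multiplicity (int p) (x s)) ` T)"
  have "v \<in> (\<lambda>s. multiplicity (int p) (x s)) ` T" unfolding v_def using T by (intro Min_in) auto
  then obtain g where g: "g \<in> T" "v = multiplicity (int p) (x g)" by auto
  have gG: "g \<in> carrier G" and gS: "g \<in> S" using g S by (auto simp: T_def)
  have dvd: "int p ^ v dvd x s" if "s \<in> T" for s
    by (rule multiplicity_dvd') (use that T in \<open>auto simp: v_def\<close>)
  \<comment> \<open>Outside \<open>T\<close> the factor \<open>s [^] x s\<close> is trivial, so the
    exponent 0 may be used there even when \<open>p ^ v\<close> does not divide
    \<open>x s\<close>.\<close>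
  define y where "y s = (if s \<in> T then x s div int p ^ v else 0)" for s
  have y: "y s * int p ^ v = x s" if "s \<in> T" for s
    using dvd[OF that] that by (simp add: y_def)
  define g' where "g' = (\<Otimes>s\<in>S. s [^] y s)"
  have g'G: "g' \<in> carrier G" unfolding g'_def using S by (auto intro!: finprod_closed)
  have "g' [^] int (p ^ v) = (\<Otimes>s\<in>S. s [^] (y s * int (p ^ v)))"
    unfolding g'_def by (rule finprod_int_pow_pow[OF S(1)])
  also have "\<dots> = (\<Otimes>s\<in>S. s [^] x s)"
  proof (intro finprod_cong')
    fix s assume "s \<in> S"
    then show "s [^] (y s * int (p ^ v)) = s [^] x s"
      using y[of s] by (cases "s \<in> T") (auto simp: T_def y_def)
  qed (use S in auto)
  finally have "g' [^] int (p ^ v) = \<one>" using rel by simp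
  then have "ord g' dvd p ^ v" using int_pow_eq_id[OF g'G] by (simp only: int_dvd_int_iff)
  then have ord_g': "ord g' \<le> p ^ v" using p by (intro dvd_imp_le) (auto simp: prime_gt_0_nat)
  have "ord g dvd p ^ e" using ord_dvd_group_order[OF gG] ord by simp
  then obtain f where f: "ord g = p ^ f" using p by (auto simp: divides_primepow_nat)
  have xg: "\<not> int (ord g) dvd x g" using g int_pow_eq_id[OF gG] by (auto simp: T_def)
  have "v < f"
  proof (rule ccontr)
    assume "\<not> v < f"
    then have "int p ^ f dvd int p ^ v" by (simp add: le_imp_power_dvd)
    then show False using dvd[OF g(1)] xg f by (auto dest: dvd_trans)
  qed
  then have less: "ord g' < ord g"
    using ord_g' f power_strict_increasing[of v f p] prime_gt_1_nat[OF p] by (metis le_less_trans)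
  have xg0: "x g \<noteq> 0" using xg by auto
  \<comment> \<open>Since \<open>v\<close> is the exact multiplicity at \<open>g\<close>, the
    exponent \<open>y g\<close> is invertible modulo the order of \<open>g\<close>. Its inverse
    \<open>z\<close> recovers \<open>g\<close> from \<open>g'\<close> and the remaining
    generators.\<close>
  have "\<not> int p dvd y g"
  proof
    assume "int p dvd y g"
    then have "int p ^ Suc v dvd x g" unfolding y[OF g(1), symmetric] by (simp add: mult_dvd_mono)
    then have "Suc v \<le> v" unfolding g(2) using xg0 p by (intro multiplicity_geI) auto
    then show False by simp
  qed
  then have "coprime (int p ^ f) (y g)" using p by (simp add: prime_imp_coprime)
  then have "coprime (y g) (int (ord g))" using f by (simp add: coprime_commute)
  then obtain z t where "z * y g + t * int (ord g) = 1"
    by (metis bezout_int coprime_imp_gcd_eq_1)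
  then have "1 - y g * z = int (ord g) * t" by (simp add: algebra_simps)
  then have z: "int (ord g) dvd 1 - y g * z" by simp
  define R where "R = (\<Otimes>s\<in>S - {g}. s [^] y s)"
  have RG: "R \<in> carrier G" unfolding R_def using S by (auto intro!: finprod_closed)
  have g'_eq: "g' = g [^] y g \<otimes> R"
  proof -
    have "g' = (\<Otimes>s\<in>insert g (S - {g}). s [^] y s)" unfolding g'_def using gS by (simp add: insert_absorb)
    also have "\<dots> = g [^] y g \<otimes> R" unfolding R_def using finS gG S by (subst finprod_insert) auto
    finally show ?thesis .
  qed
  define S' where "S' = insert g' (S - {g})"
  have S': "S' \<subseteq> carrier G" using S g'G by (auto simp: S'_def)
  have gen: "subgroup (generate G S') G" by (rule generate_is_subgroup[OF S'])
  have "R \<in> generate G S'" unfolding R_def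
    by (intro subgroup_finprod_closed[OF gen] subgroup_int_pow_closed[OF gen] generate.incl)
      (auto simp: S'_def)
  moreover have "g' \<in> generate G S'" by (auto intro!: generate.incl simp: S'_def)
  ultimately have "g' \<otimes> inv R \<in> generate G S'"
    using gen by (simp add: subgroup.m_closed subgroup.m_inv_closed)
  moreover have "g' \<otimes> inv R = g [^] y g" using g'_eq RG gG by (simp add: m_assoc)
  ultimately have "(g [^] y g) [^] z \<in> generate G S'"
    using subgroup_int_pow_closed[OF gen] by simp
  moreover have "(g [^] y g) [^] z = g [^] (1::int)"
    using z gG by (simp only: int_pow_pow int_pow_eq)
  ultimately have "g \<in> generate G S'" using gG by simp
  then have "S \<subseteq> generate G S'" by (auto intro: generate.incl simp: S'_def)
  then have "generate G S \<subseteq> generate G S'" by (rule generate_subgroup_incl[OF _ gen])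
  then have "generate G S' = carrier G" using S(2) generate_incl[OF S'] by auto
  moreover have "(\<Sum>s\<in>S'. ord s) < (\<Sum>s\<in>S. ord s)"
  proof -
    \<comment> \<open>Only an inequality, since \<open>g'\<close> may coincide with one of the
      remaining generators.\<close>
    have "(\<Sum>s\<in>S'. ord s) \<le> ord g' + (\<Sum>s\<in>S - {g}. ord s)"
      unfolding S'_def using finS by (cases "g' \<in> S - {g}") (auto simp: insert_absorb)
    also have "\<dots> < ord g + (\<Sum>s\<in>S - {g}. ord s)" using less by simp
    also have "\<dots> = (\<Sum>s\<in>S. ord s)" using finS gS by (simp add: sum.remove)
    finally show ?thesis .
  qed
  ultimately show ?thesis using S' by blast
qed

text \<open>A generating set with the least sum of orders works: a nontrivial relation would allow
  an exchange that lowers the sum, and the identity could simply be dropped.\<close>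

lemma p_group_basis_exists:
  assumes fin: "finite (carrier G)" and p: "prime p" and ord: "Coset.order G = p ^ e"
  shows "\<exists>S \<subseteq> carrier G. generate G S = carrier G \<and> (\<forall>s\<in>S. ord s > 1) \<and>
    (\<forall>x. (\<Otimes>s\<in>S. s [^] (x s :: int)) = \<one> \<longrightarrow> (\<forall>s\<in>S. s [^] x s = \<one>))"
proof -
  let ?P = "\<lambda>S. S \<subseteq> carrier G \<and> generate G S = carrier G"
  have "?P (carrier G)" using generate_incl[of "carrier G"] by (auto intro: generate.incl)
  then obtain S where S: "?P S" and least: "\<And>S'. ?P S' \<Longrightarrow> (\<Sum>s\<in>S. ord s) \<le> (\<Sum>s\<in>S'. ord s)"
    using ex_has_least_nat[of ?P "carrier G" "\<lambda>S. \<Sum>s\<in>S. ord s"] by auto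
  show ?thesis
  proof (intro exI[of _ S] conjI allI impI ballI)
    show "S \<subseteq> carrier G" "generate G S = carrier G" using S by auto
    fix x s assume rel: "(\<Otimes>s\<in>S. s [^] (x s :: int)) = \<one>" and s: "s \<in> S"
    show "s [^] x s = \<one>"
    proof (rule ccontr)
      assume "s [^] x s \<noteq> \<one>"
      then obtain S' where "?P S'" "(\<Sum>s\<in>S'. ord s) < (\<Sum>s\<in>S. ord s)"
        using p_group_generators_exchange[OF fin p ord _ _ rel] S s by blast
      then show False using least[of S'] by simp
    qed
  next
    fix s assume s: "s \<in> S"
    show "ord s > 1"
    proof (rule ccontr)
      assume "\<not> 1 < ord s"
      moreover have "ord s \<ge> 1" using ord_ge_1[OF fin] s S by auto
      ultimately have "ord s = 1" by simp
      then have "s = \<one>" using ord_eq_1 s S by auto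
      then have "S \<subseteq> generate G (S - {s})" by (auto intro: generate.one generate.incl)
      moreover have "subgroup (generate G (S - {s})) G" using S by (intro generate_is_subgroup) auto
      ultimately have "generate G S \<subseteq> generate G (S - {s})" by (rule generate_subgroup_incl)
      then have "?P (S - {s})" using S generate_incl[of "S - {s}"] by auto
      from least[OF this] show False
        using \<open>ord s = 1\<close> s S finite_subset[OF _ fin, of S] by (simp add: sum.remove[of S s])
    qed
  qed
qed

text \<open>The orders of the basis elements are powers of \<open>p\<close>, so sorting the basis by
  order already yields a divisibility chain. Generation gives surjectivity of the exponent map and
  independence gives injectivity.\<close>

theorem p_group_invariant_factors_exist:
  assumes fin: "finite (carrier G)" and p: "prime p" and ord: "Coset.order G = p ^ e"
  shows "\<exists>ds. invariant_factors G ds"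
proof -
  obtain S where S: "S \<subseteq> carrier G" "generate G S = carrier G"
    and ord1: "\<And>s. s \<in> S \<Longrightarrow> ord s > 1"
    and indep: "\<forall>x. (\<Otimes>s\<in>S. s [^] (x s :: int)) = \<one> \<longrightarrow> (\<forall>s\<in>S. s [^] x s = \<one>)"
    using p_group_basis_exists[OF fin p ord] by auto
  have finS: "finite S" using S(1) fin by (rule finite_subset)
  then obtain xs where xs: "set xs = S" "distinct xs" using finite_distinct_list by blast
  define gs where "gs = sort_key ord xs"
  define r where "r = length gs"
  define ds where "ds = map ord gs"
  have gs: "set gs = S" "distinct gs" using xs by (simp_all add: gs_def)
  have gsG: "gs ! i \<in> carrier G" if "i < r" for i using that gs S by (auto simp: r_def)
  have inj: "inj_on ((!) gs) {..<r}" using gs(2) by (simp add: inj_on_nth r_def)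
  have img: "(!) gs ` {..<r} = S" using gs(1) by (auto simp: r_def set_conv_nth)
  have to_S: "(\<Otimes>i\<in>{..<r}. gs ! i [^] (x (gs ! i) :: int)) = (\<Otimes>s\<in>S. s [^] x s)" for x
    using finprod_reindex[OF _ inj, of "\<lambda>s. s [^] x s"] img S(1) by (auto simp: Pi_iff subset_eq)
  have sorted_ds: "sorted ds" unfolding ds_def gs_def by simp
  have "d dvd d'" if "d \<in> set ds" "d' \<in> set ds" "d \<le> d'" for d d'
  proof -
    have "\<exists>f. d = p ^ f" if "d \<in> set ds" for d
      using that ord_dvd_group_order S(1) gs(1) p unfolding ord ds_def
      by (auto simp: divides_primepow_nat)
    with that(1,2) obtain f f' where "d = p ^ f" "d' = p ^ f'" by blast
    with \<open>d \<le> d'\<close> prime_gt_1_nat[OF p] show ?thesis by (simp add: le_imp_power_dvd)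
  qed
  then have dvd_ds: "sorted_wrt (dvd) ds"
    by (intro sorted_wrt_mono_rel[OF _ sorted_ds]) auto
  let ?H = "product_group {..<r} (\<lambda>i. integer_mod_group (ds ! i))"
  let ?\<phi> = "\<lambda>x. \<Otimes>i\<in>{..<r}. gs ! i [^] (x i :: int)"
  have ds_nth: "ds ! i = ord (gs ! i)" if "i < r" for i using that by (simp add: ds_def r_def)
  \<comment> \<open>Addition in \<open>?H\<close> reduces exponents modulo the order of
    \<open>gs ! i\<close>, which powers of \<open>gs ! i\<close> do not notice.\<close>
  have pow_mod: "gs ! i [^] (z mod int (ds ! i)) = gs ! i [^] z" if "i < r" for i z
    using that gsG by (simp add: ds_nth int_pow_eq mod_eq_dvd_iff[symmetric])
  have ds_pos: "ds ! i > 0" if "i < r" for i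
    using ord1[of "gs ! i"] that gs nth_mem[of i gs] by (simp add: ds_nth r_def)
  have H: "group ?H" by simp
  interpret H: group ?H by (rule H)
  have hom: "?\<phi> \<in> hom ?H G"
  proof (rule homI)
    fix x assume "x \<in> carrier ?H"
    show "?\<phi> x \<in> carrier G" using gsG by (auto intro!: finprod_closed)
  next
    fix x y assume "x \<in> carrier ?H" "y \<in> carrier ?H"
    have "?\<phi> (x \<otimes>\<^bsub>?H\<^esub> y) = (\<Otimes>i\<in>{..<r}. gs ! i [^] x i \<otimes> gs ! i [^] y i)"
      using gsG by (intro finprod_cong') (auto simp: pow_mod int_pow_mult)
    also have "\<dots> = ?\<phi> x \<otimes> ?\<phi> y" using gsG by (intro finprod_multf) auto
    finally show "?\<phi> (x \<otimes>\<^bsub>?H\<^esub> y) = ?\<phi> x \<otimes> ?\<phi> y" .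
  qed
  interpret \<phi>: group_hom ?H G ?\<phi>
    by (intro group_hom.intro group_hom_axioms.intro H is_group hom)
  have "?\<phi> \<in> iso ?H G"
    unfolding \<phi>.iso_iff
  proof (intro conjI ballI impI subsetI)
    fix t assume "t \<in> carrier G"
    then obtain x where x: "t = (\<Otimes>s\<in>S. s [^] (x s :: int))"
      using generate_finite_eq[OF finS S(1)] S(2) by auto
    let ?x = "\<lambda>i\<in>{..<r}. x (gs ! i) mod int (ds ! i)"
    have "?x \<in> carrier ?H"
      using ds_pos by (auto simp: carrier_integer_mod_group)
    moreover have "?\<phi> ?x = (\<Otimes>i\<in>{..<r}. gs ! i [^] x (gs ! i))"
      using gsG by (intro finprod_cong') (auto simp: pow_mod)
    then have "?\<phi> ?x = t" unfolding x to_S .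
    ultimately show "t \<in> ?\<phi> ` carrier ?H" by (intro image_eqI[of t ?\<phi> ?x]) simp_all
  next
    fix x assume x: "x \<in> carrier ?H" and "?\<phi> x = \<one>"
    \<comment> \<open>Independence speaks of exponents indexed by group elements, so the vector
      \<open>x\<close> is transported along the enumeration \<open>gs\<close>.\<close>
    define x' :: "'a \<Rightarrow> int" where "x' s = x (the_inv_into {..<r} ((!) gs) s)" for s
    have x': "x' (gs ! i) = x i" if "i < r" for i
      using that inj by (simp add: x'_def the_inv_into_f_f)
    have "(\<Otimes>s\<in>S. s [^] x' s) = ?\<phi> x"
      unfolding to_S[symmetric] using gsG by (intro finprod_cong') (auto simp: x')
    then have rel: "(\<Otimes>s\<in>S. s [^] x' s) = \<one>" using \<open>?\<phi> x = \<one>\<close> by simp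
    have "x i = 0" if "i < r" for i
    proof -
      have "gs ! i [^] x' (gs ! i) = \<one>" using indep rel that gs nth_mem[of i gs] by (simp add: r_def)
      then have "gs ! i [^] x i = \<one>" using x'[OF that] by simp
      then have "int (ds ! i) dvd x i" using that gsG by (simp add: int_pow_eq_id ds_nth)
      moreover have "0 \<le> x i" "x i < int (ds ! i)"
        using x that ds_pos[OF that]
        by (auto simp: PiE_iff carrier_integer_mod_group dest!: bspec[of _ _ i])
      ultimately show ?thesis by (metis mod_pos_pos_trivial dvd_imp_mod_0)
    qed
    moreover have "x \<in> extensional {..<r}" using x by (simp add: PiE_iff)
    ultimately show "x = \<one>\<^bsub>?H\<^esub>"
      unfolding one_product_group by (intro extensionalityI[of x "{..<r}"]) auto
  qed
  then have "?H \<cong> G" by (rule is_isoI)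
  then have "G \<cong> ?H" using H.iso_sym by blast
  moreover have "length ds = r" "\<forall>d\<in>set ds. 1 < d" using ord1 gs by (auto simp: ds_def r_def)
  ultimately have "invariant_factors G ds"
    unfolding invariant_factors_def using dvd_ds by simp
  then show ?thesis by blast
qed

end

section \<open>Integer coordinates on finite abelian groups\<close>

lemma card_carrier_invariant_factors:
  assumes "invariant_factors G ds"
  shows "Coset.order G = prod_list ds"
proof -
  have "G \<cong> product_group {..<length ds} (\<lambda>i. integer_mod_group (ds ! i))"
    using assms by (simp add: invariant_factors_def)
  from iso_same_card[OF this]
  have "Coset.order G = card (PiE {..<length ds} (\<lambda>i. carrier (integer_mod_group (ds ! i))))"
    by (simp add: Coset.order_def)
  also have "\<dots> = (\<Prod>i<length ds. card (carrier (integer_mod_group (ds ! i))))"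
    by (rule card_PiE) simp
  also have "\<dots> = (\<Prod>i<length ds. ds ! i)"
  proof (rule prod.cong)
    fix i assume "i \<in> {..<length ds}"
    then have "1 < ds ! i" using assms by (auto simp: invariant_factors_def)
    then show "card (carrier (integer_mod_group (ds ! i))) = ds ! i"
      by (simp add: carrier_integer_mod_group)
  qed simp
  also have "\<dots> = prod_list ds"
    by (simp add: prod.list_conv_set_nth atLeast0LessThan)
  finally show ?thesis .
qed

text \<open>For the trivial group the chosen list has product 1 and entries above 1. It is therefore
  empty, and its sum agrees with the value 0 that \<open>dstar\<close> assigns.\<close>

lemma dstar_invariant_factors:
  assumes "\<exists>ds. invariant_factors G ds"
  obtains ds where "invariant_factors G ds" "dstar G = (\<Sum>d\<leftarrow>ds. d - 1)"
proof
  let ?ds = "SOME ds. invariant_factors G ds"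
  show inv: "invariant_factors G ?ds" using assms by (rule someI_ex)
  show "dstar G = (\<Sum>d\<leftarrow>?ds. d - 1)"
  proof (cases "Coset.order G = 1")
    case True
    have "?ds = []"
    proof (rule ccontr)
      assume "?ds \<noteq> []"
      then obtain d ds' where ds: "?ds = d # ds'" by (cases ?ds) auto
      then have "d dvd 1" using card_carrier_invariant_factors[OF inv] True by simp
      moreover have "1 < d" using inv ds by (auto simp: invariant_factors_def)
      ultimately show False by simp
    qed
    then show ?thesis using True by (simp add: dstar_def)
  qed (simp add: dstar_def)
qed

text \<open>The coordinates of an isomorphism onto the product are reduced residues, so equality in
  \<open>G\<close> amounts to congruence of each coordinate. The group condition becomes
  divisibility of linear forms in the indicators of \<open>I\<close>.\<close>

lemma invariant_factors_coordinates:
  assumes "comm_group G" "invariant_factors G ds"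
  shows "\<exists>\<psi> :: 'g \<Rightarrow> nat \<Rightarrow> int. \<forall>(I :: 'i set) cs c. finite I \<longrightarrow> cs \<in> I \<rightarrow> carrier G \<longrightarrow> c \<in> carrier G \<longrightarrow>
    finprod G cs I = c \<longleftrightarrow> (\<forall>i<length ds. int (ds ! i) dvd (\<Sum>s\<in>I. \<psi> (cs s) i) - \<psi> c i)"
proof -
  interpret comm_group G by fact
  let ?H = "product_group {..<length ds} (\<lambda>i. integer_mod_group (ds ! i))"
  obtain \<psi> where \<psi>: "\<psi> \<in> iso G ?H" using assms(2) by (auto simp: invariant_factors_def is_iso_def)
  interpret \<psi>: group_hom G ?H \<psi>
    using \<psi> by (intro group_hom.intro group_hom_axioms.intro is_group) (auto simp: iso_def)
  have inj: "inj_on \<psi> (carrier G)" using \<psi> by (auto simp: iso_def bij_betw_def)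
  have bound: "0 \<le> \<psi> g i \<and> \<psi> g i < int (ds ! i)" if "g \<in> carrier G" "i < length ds" for g i
  proof -
    have "1 < ds ! i" using that assms(2) by (auto simp: invariant_factors_def)
    then show ?thesis
      using \<psi>.hom_closed[OF that(1)] that(2)
      by (auto simp: PiE_iff carrier_integer_mod_group dest!: bspec[of _ _ i])
  qed
  have ext: "\<psi> g \<in> extensional {..<length ds}" if "g \<in> carrier G" for g
    using \<psi>.hom_closed[OF that] by (simp add: PiE_iff)
  have sum: "\<psi> (finprod G cs I) i = (\<Sum>s\<in>I. \<psi> (cs s) i) mod int (ds ! i)"
    if "finite I" "cs \<in> I \<rightarrow> carrier G" "i < length ds" for I i and cs :: "'i \<Rightarrow> 'g"
    using that
  proof (induction I)
    case empty
    then show ?case by (simp add: one_product_group)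
  next
    case (insert s I)
    then have "cs \<in> I \<rightarrow> carrier G" "cs s \<in> carrier G" by auto
    with insert show ?case by (simp add: finprod_closed mod_add_right_eq)
  qed
  have "finprod G cs I = c \<longleftrightarrow> (\<forall>i<length ds. int (ds ! i) dvd (\<Sum>s\<in>I. \<psi> (cs s) i) - \<psi> c i)"
    if I: "finite I" "cs \<in> I \<rightarrow> carrier G" "c \<in> carrier G" for I and cs :: "'i \<Rightarrow> 'g" and c
  proof -
    have fG: "finprod G cs I \<in> carrier G" using I by (auto intro: finprod_closed)
    have "finprod G cs I = c \<longleftrightarrow> \<psi> (finprod G cs I) = \<psi> c"
      using inj fG I(3) by (auto dest: inj_onD)
    also have "\<dots> \<longleftrightarrow> (\<forall>i<length ds. \<psi> (finprod G cs I) i = \<psi> c i)"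
      using extensionalityI[OF ext[OF fG] ext[OF I(3)]] by auto
    also have "\<dots> \<longleftrightarrow> (\<forall>i<length ds. (\<Sum>s\<in>I. \<psi> (cs s) i) mod int (ds ! i) = \<psi> c i mod int (ds ! i))"
      using sum[OF I(1,2)] bound[OF I(3)] by (auto simp: mod_pos_pos_trivial)
    finally show ?thesis by (simp add: mod_eq_dvd_iff)
  qed
  then show ?thesis by blast
qed

text \<open>Each invariant factor divides the group order and is thus a power of \<open>p\<close>.
  The indicators of the \<open>r\<close> divisibility conditions then have total degree exactly
  \<open>dstar G\<close>.\<close>

lemma p_group_coordinates:
  assumes "comm_group G" "finite (carrier G)" "prime p" "is_p_group p G"
  shows "\<exists>r t. \<exists>\<psi> :: 'g \<Rightarrow> nat \<Rightarrow> int. dstar G = (\<Sum>i<r. p ^ t i - 1) \<and>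
    (\<forall>(I :: 'i set) cs c. finite I \<longrightarrow> cs \<in> I \<rightarrow> carrier G \<longrightarrow> c \<in> carrier G \<longrightarrow>
      finprod G cs I = c \<longleftrightarrow> (\<forall>i<r. int (p ^ t i) dvd (\<Sum>s\<in>I. \<psi> (cs s) i) - \<psi> c i))"
proof -
  obtain e where e: "Coset.order G = p ^ e" using assms(4) by (auto simp: is_p_group_def)
  obtain ds where ds: "invariant_factors G ds" "dstar G = (\<Sum>d\<leftarrow>ds. d - 1)"
    using dstar_invariant_factors[OF comm_group.p_group_invariant_factors_exist[OF assms(1-3) e]] by blast
  obtain \<psi> :: "'g \<Rightarrow> nat \<Rightarrow> int" where
    \<psi>: "\<forall>(I :: 'i set) cs c. finite I \<longrightarrow> cs \<in> I \<rightarrow> carrier G \<longrightarrow> c \<in> carrier G \<longrightarrow>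
      finprod G cs I = c \<longleftrightarrow> (\<forall>i<length ds. int (ds ! i) dvd (\<Sum>s\<in>I. \<psi> (cs s) i) - \<psi> c i)"
    using invariant_factors_coordinates[OF assms(1) ds(1)] by blast
  have "\<exists>t. ds ! i = p ^ t" if i: "i < length ds" for i
  proof -
    obtain xs ys where "ds = xs @ ds ! i # ys" using split_list[OF nth_mem[OF i]] by auto
    then have "prod_list ds = prod_list xs * (ds ! i * prod_list ys)"
      by (metis prod_list.append prod_list.Cons)
    then have "p ^ e = ds ! i * (prod_list xs * prod_list ys)"
      using e card_carrier_invariant_factors[OF ds(1)] by (simp only: mult_ac)
    then have "ds ! i dvd p ^ e" by (rule dvdI)
    then show ?thesis using assms(3) by (auto simp: divides_primepow_nat)
  qed
  then obtain t where t: "\<And>i. i < length ds \<Longrightarrow> ds ! i = p ^ t i" by metis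
  show ?thesis
  proof (intro exI conjI)
    show "dstar G = (\<Sum>i<length ds. p ^ t i - 1)"
      using t ds(2) by (simp add: sum_list_sum_nth atLeast0LessThan)
    show "\<forall>(I :: 'i set) cs c. finite I \<longrightarrow> cs \<in> I \<rightarrow> carrier G \<longrightarrow> c \<in> carrier G \<longrightarrow>
      finprod G cs I = c \<longleftrightarrow> (\<forall>i<length ds. int (p ^ t i) dvd (\<Sum>s\<in>I. \<psi> (cs s) i) - \<psi> c i)"
      using \<psi> t by simp
  qed
qed

section \<open>Integers of cyclotomic fields\<close>

text \<open>Algebraic integers are recognised as eigenvalues of integer matrices; for an integer polynomial
  in a root of unity the powers of that root form an eigenvector.\<close>

lemma algebraic_int_eigenvalue:
  fixes w :: complex and v :: "nat \<Rightarrow> complex"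
  assumes "\<And>i. i < N \<Longrightarrow> w * v i = (\<Sum>j<N. of_int (A i j) * v j)" and "i < N" "v i \<noteq> 0"
  shows "algebraic_int w"
proof -
  define M where "M = mat N N (\<lambda>(i, j). A i j)"
  have M: "M \<in> carrier_mat N N" by (simp add: M_def)
  let ?M = "map_mat (of_int :: int \<Rightarrow> complex) M"
  have M': "?M \<in> carrier_mat N N" using M by simp
  interpret of_int_hom: comm_ring_hom "of_int :: int \<Rightarrow> complex" by unfold_locales auto
  have "eigenvector ?M (vec N v) w"
    unfolding eigenvector_def
  proof (intro conjI)
    have "vec N v $ i \<noteq> 0\<^sub>v N $ i" using assms(2,3) by simp
    then show "vec N v \<noteq> 0\<^sub>v (dim_row ?M)" using M by auto
    show "?M *\<^sub>v vec N v = w \<cdot>\<^sub>v vec N v"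
      by (rule eq_vecI)
        (auto simp: M_def scalar_prod_def assms(1) atLeast0LessThan)
  qed (use M in auto)
  then have "eigenvalue ?M w" by (auto simp: eigenvalue_def)
  then have "poly (char_poly ?M) w = 0" using eigenvalue_root_char_poly[OF M'] by simp
  moreover have "lead_coeff (char_poly M) = 1" using degree_monic_char_poly[OF M] by simp
  ultimately show ?thesis
    unfolding algebraic_int_altdef_ipoly by (metis of_int_hom.char_poly_hom[OF M])
qed

section \<open>Exponentials at rational arguments and the ring they generate\<close>

definition unit_exp :: "rat \<Rightarrow> complex"
  where "unit_exp x = exp (2 * of_real pi * \<i> * of_rat x)"

lemma unit_exp_add: "unit_exp (x + y) = unit_exp x * unit_exp y"
  by (simp add: unit_exp_def of_rat_add distrib_left exp_add)

lemma unit_exp_0 [simp]: "unit_exp 0 = 1"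
  by (simp add: unit_exp_def)

lemma unit_exp_sum: "unit_exp (\<Sum>s\<in>I. f s) = (\<Prod>s\<in>I. unit_exp (f s))"
  by (induction I rule: infinite_finite_induct) (auto simp: unit_exp_add)

lemma unit_exp_power: "unit_exp x ^ n = unit_exp (of_nat n * x)"
  by (induction n) (auto simp: unit_exp_add distrib_right)

lemma unit_exp_eq_1_iff: "unit_exp x = 1 \<longleftrightarrow> x \<in> \<int>"
proof -
  obtain a b where x: "x = of_int a / of_int b" using quotient_of_div surj_pair by metis
  have "unit_exp x = cis (2 * pi * real_of_rat x)"
    by (simp add: unit_exp_def cis_conv_exp mult_ac x of_rat_divide)
  then have "unit_exp x = 1 \<longleftrightarrow> cis (2 * pi * real_of_rat x) = 1" by simp
  also have "\<dots> \<longleftrightarrow> cos (2 * pi * real_of_rat x) = 1"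
    by (auto simp: complex_eq_iff cos_one_sin_zero)
  also have "\<dots> \<longleftrightarrow> (\<exists>n::int. real_of_rat x = of_int n)"
    by (auto simp: cos_one_2pi_int)
  also have "\<dots> \<longleftrightarrow> x \<in> \<int>" by (metis of_rat_of_int_eq of_rat_eq_iff Ints_cases Ints_of_int)
  finally show ?thesis .
qed

lemma unit_exp_1 [simp]: "unit_exp 1 = 1"
  by (simp add: unit_exp_eq_1_iff)

text \<open>This is the ring generated over the integers by \<open>e(1/N)\<close>. Presenting it by
  polynomial values makes ring closure immediate, and integrality is proved once for all its
  elements.\<close>

definition cyclotomic_integers :: "nat \<Rightarrow> complex set"
  where "cyclotomic_integers N = range (\<lambda>q. poly (of_int_poly q) (unit_exp (1 / of_nat N)))"

lemma cyclotomic_integers_of_int [simp, intro]: "of_int z \<in> cyclotomic_integers N"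
  unfolding cyclotomic_integers_def by (rule image_eqI[of _ _ "Polynomial.monom z 0"]) (auto simp: poly_monom)

lemma cyclotomic_integers_add [intro]:
  assumes "x \<in> cyclotomic_integers N" "y \<in> cyclotomic_integers N"
  shows "x + y \<in> cyclotomic_integers N"
  using assms unfolding cyclotomic_integers_def
  by (auto simp flip: poly_add of_int_poly_hom.hom_add)

lemma cyclotomic_integers_mult [intro]:
  assumes "x \<in> cyclotomic_integers N" "y \<in> cyclotomic_integers N"
  shows "x * y \<in> cyclotomic_integers N"
  using assms unfolding cyclotomic_integers_def
  by (auto simp flip: poly_mult of_int_poly_hom.hom_mult)

lemma cyclotomic_integers_sum [intro]:
  "(\<And>i. i \<in> I \<Longrightarrow> f i \<in> cyclotomic_integers N) \<Longrightarrow> (\<Sum>i\<in>I. f i) \<in> cyclotomic_integers N"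
  by (induction I rule: infinite_finite_induct)
    (use cyclotomic_integers_of_int[of 0 N] in auto)

lemma unit_exp_in_cyclotomic_integers:
  assumes "N > 0" "of_nat N * x \<in> \<int>"
  shows "unit_exp x \<in> cyclotomic_integers N"
proof -
  obtain z :: int where z: "of_nat N * x = of_int z" using assms(2) by (auto elim: Ints_cases)
  \<comment> \<open>Polynomials allow only nonnegative powers, so the numerator is reduced modulo
    \<open>N\<close>; this shifts the argument by an integer.\<close>
  define j where "j = nat (z mod int N)"
  have "int j = z - int N * (z div int N)" using assms(1) by (simp add: j_def minus_mult_div_eq_mod)
  then have "(of_nat j :: rat) = of_int (z - int N * (z div int N))" by (metis of_int_of_nat_eq)
  then have "of_nat j * (1 / of_nat N) = x + (- of_int (z div int N))"
    using z assms(1) by (simp add: field_simps)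
  then have "unit_exp (1 / of_nat N) ^ j = unit_exp x * unit_exp (- of_int (z div int N))"
    by (simp only: unit_exp_power unit_exp_add)
  moreover have "unit_exp (- of_int (z div int N)) = 1" by (simp add: unit_exp_eq_1_iff)
  ultimately have "unit_exp x = poly (of_int_poly (Polynomial.monom 1 j)) (unit_exp (1 / of_nat N))"
    by (simp add: poly_monom)
  then show ?thesis unfolding cyclotomic_integers_def by blast
qed

lemma algebraic_int_cyclotomic_integers:
  assumes "N > 0" "w \<in> cyclotomic_integers N"
  shows "algebraic_int w"
proof -
  define \<zeta> where "\<zeta> = unit_exp (1 / of_nat N)"
  have \<zeta>: "\<zeta> ^ N = 1" using assms(1) by (simp add: \<zeta>_def unit_exp_power)
  have \<zeta>_mod: "\<zeta> ^ (l mod N) = \<zeta> ^ l" for l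
  proof -
    have "\<zeta> ^ l = \<zeta> ^ (N * (l div N) + l mod N)" by simp
    also have "\<dots> = \<zeta> ^ (l mod N)" by (simp only: power_add power_mult \<zeta>) simp
    finally show ?thesis ..
  qed
  obtain q where q: "w = poly (of_int_poly q) \<zeta>"
    using assms(2) by (auto simp: cyclotomic_integers_def \<zeta>_def)
  \<comment> \<open>Multiplication by \<open>\<zeta> ^ l\<close> shifts the powers of
    \<open>\<zeta>\<close> cyclically; \<open>A i j\<close> collects the coefficients of
    \<open>q\<close> that carry index \<open>i\<close> to index \<open>j\<close>.\<close>
  define A where "A i j = (\<Sum>l | l \<le> degree q \<and> (l + i) mod N = j. Polynomial.coeff q l)" for i j
  have "w * \<zeta> ^ i = (\<Sum>j<N. of_int (A i j) * \<zeta> ^ j)" for i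
  proof -
    have "w * \<zeta> ^ i = (\<Sum>l\<le>degree q. of_int (Polynomial.coeff q l) * \<zeta> ^ ((l + i) mod N))"
      by (simp add: q poly_altdef sum_distrib_right power_add \<zeta>_mod mult.assoc)
    also have "\<dots> = (\<Sum>j<N. \<Sum>l | l \<in> {..degree q} \<and> (l + i) mod N = j.
        of_int (Polynomial.coeff q l) * \<zeta> ^ ((l + i) mod N))"
      using assms(1) by (intro sum.group[symmetric]) auto
    also have "\<dots> = (\<Sum>j<N. of_int (A i j) * \<zeta> ^ j)"
      unfolding A_def by (intro sum.cong) (auto simp: sum_distrib_right)
    finally show ?thesis .
  qed
  then show ?thesis
    by (intro algebraic_int_eigenvalue[of N w "\<lambda>i. \<zeta> ^ i" A 0]) (use assms(1) in auto)
qed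

text \<open>For nonintegral \<open>x\<close> this is a geometric sum whose ratio differs from 1
  while its \<open>N\<close>-th power is 1.\<close>

lemma unit_exp_geometric_sum:
  assumes "of_nat N * x \<in> \<int>"
  shows "(\<Sum>j<N. unit_exp (of_nat j * x)) = (if x \<in> \<int> then of_nat N else 0)"
proof (cases "x \<in> \<int>")
  case True
  then have "unit_exp (of_nat j * x) = 1" for j by (simp add: unit_exp_eq_1_iff)
  with True show ?thesis by simp
next
  case False
  have "(\<Sum>j<N. unit_exp (of_nat j * x)) = (\<Sum>j<N. unit_exp x ^ j)" by (simp add: unit_exp_power)
  also have "\<dots> = (unit_exp x ^ N - 1) / (unit_exp x - 1)"
    using False by (intro geometric_sum) (simp add: unit_exp_eq_1_iff)
  also have "unit_exp x ^ N = 1" using assms by (simp add: unit_exp_power unit_exp_eq_1_iff)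
  finally show ?thesis using False by simp
qed

section \<open>Weighted sums over covers\<close>

lemma cover_weighted_sum_eq_0:
  fixes U :: "'i set" and m a :: "'i \<Rightarrow> int" and n :: "'i \<Rightarrow> nat" and \<alpha> :: rat
    and F :: "'i set \<Rightarrow> complex"
  defines "\<sigma> \<equiv> \<lambda>I. \<Sum>s\<in>I. of_int (m s) / of_nat (n s) :: rat"
  assumes U: "finite U" and n: "\<And>s. s \<in> U \<Longrightarrow> n s > 0"
    and F: "set_poly D F"
    and cover: "\<And>x. D < card {s \<in> U. int (n s) dvd a s - x}"
  shows "(\<Sum>I | I \<subseteq> U \<and> \<sigma> I - \<alpha> \<in> \<int>.
    (-1) ^ card I * unit_exp (\<Sum>s\<in>I. of_int (a s * m s) / of_nat (n s)) * F I) = 0"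
proof -
  obtain b q where \<alpha>: "\<alpha> = of_int b / of_int q" "q > 0"
    using quotient_of_div quotient_of_denom_pos surj_pair by metis
  \<comment> \<open>\<open>N\<close> clears the denominators of \<open>\<alpha>\<close> and of all
    \<open>m s / n s\<close>, so the average over \<open>x < N\<close> runs over full
    periods.\<close>
  define N where "N = (\<Prod>s\<in>U. n s) * nat q"
  have "N > 0" unfolding N_def using n \<alpha>(2) by (auto intro!: prod_pos)
  have N\<alpha>: "of_nat N * \<alpha> \<in> \<int>"
    using \<alpha> by (auto simp: N_def intro!: Ints_mult Ints_prod)
  have Nn: "of_nat N * (of_int (m s) / of_nat (n s)) \<in> (\<int> :: rat set)" if "s \<in> U" for s
  proof -
    have "n s dvd N" unfolding N_def using that U by (intro dvd_mult2 dvd_prodI) auto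
    then obtain l where "N = n s * l" by blast
    then show ?thesis using n[OF that] by (simp add: Ints_mult)
  qed
  have N\<sigma>: "of_nat N * (\<alpha> - \<sigma> I) \<in> \<int>" if "I \<subseteq> U" for I
    unfolding \<sigma>_def right_diff_distrib sum_distrib_left
    by (intro Ints_diff N\<alpha> Ints_sum Nn) (use that in auto)
  define A where "A I = (-1) ^ card I * unit_exp (\<Sum>s\<in>I. of_int (a s * m s) / of_nat (n s))" for I
  define w where "w x s = - unit_exp (of_int ((a s - int x) * m s) / of_nat (n s))" for x s
  have w_prod: "(\<Prod>s\<in>I. w x s) = A I * unit_exp (- (of_nat x * \<sigma> I))" if "I \<subseteq> U" for x I
  proof -
    have "(\<Prod>s\<in>I. w x s) = (-1) ^ card I * unit_exp (\<Sum>s\<in>I. of_int ((a s - int x) * m s) / of_nat (n s))"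
      unfolding w_def prod_uminus by (simp add: unit_exp_sum)
    also have "(\<Sum>s\<in>I. of_int ((a s - int x) * m s) / of_nat (n s)) =
        (\<Sum>s\<in>I. of_int (a s * m s) / of_nat (n s)) + - (of_nat x * \<sigma> I)"
      by (simp add: \<sigma>_def sum_distrib_left sum_subtractf[symmetric] left_diff_distrib diff_divide_distrib)
    finally show ?thesis by (simp only: A_def unit_exp_add mult.assoc)
  qed
  have vanish: "(\<Sum>I\<in>Pow U. (\<Prod>s\<in>I. w x s) * F I) = 0" for x
  proof (rule set_poly_weighted_sum_eq_0[OF F U])
    \<comment> \<open>An inclusion suffices: a common factor of \<open>m s\<close> and
      \<open>n s\<close> may make further weights equal to -1.\<close>
    have sub: "{s \<in> U. int (n s) dvd a s - int x} \<subseteq> {s \<in> U. w x s = - 1}"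
    proof clarify
      fix s assume s: "s \<in> U" "int (n s) dvd a s - int x"
      then obtain z where "a s - int x = int (n s) * z" by blast
      then have "of_int ((a s - int x) * m s) / of_nat (n s) = (of_int (z * m s) :: rat)"
        using n[OF s(1)] by simp
      then show "w x s = - 1" by (simp add: w_def unit_exp_eq_1_iff)
    qed
    show "D < card {s \<in> U. w x s = - 1}"
      by (rule less_le_trans[OF cover card_mono[OF _ sub]]) (use U in auto)
  qed
  have "0 = (\<Sum>x<N. unit_exp (of_nat x * \<alpha>) * (\<Sum>I\<in>Pow U. (\<Prod>s\<in>I. w x s) * F I))"
    by (simp add: vanish)
  also have "\<dots> = (\<Sum>x<N. \<Sum>I\<in>Pow U. A I * F I * unit_exp (of_nat x * (\<alpha> - \<sigma> I)))"
    by (simp add: sum_distrib_left w_prod right_diff_distrib unit_exp_add[symmetric]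
        mult_ac flip: diff_conv_add_uminus unit_exp_add)
  also have "\<dots> = (\<Sum>I\<in>Pow U. A I * F I * (\<Sum>x<N. unit_exp (of_nat x * (\<alpha> - \<sigma> I))))"
    by (subst sum.swap) (simp add: sum_distrib_left)
  also have "\<dots> = (\<Sum>I\<in>Pow U. if \<sigma> I - \<alpha> \<in> \<int> then A I * F I * of_nat N else 0)"
  proof (rule sum.cong)
    fix I assume "I \<in> Pow U"
    moreover have "\<alpha> - \<sigma> I \<in> \<int> \<longleftrightarrow> \<sigma> I - \<alpha> \<in> \<int>" by (metis Ints_minus minus_diff_eq)
    ultimately show "A I * F I * (\<Sum>x<N. unit_exp (of_nat x * (\<alpha> - \<sigma> I))) =
        (if \<sigma> I - \<alpha> \<in> \<int> then A I * F I * of_nat N else 0)"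
      using unit_exp_geometric_sum[OF N\<sigma>, of I] by simp
  qed simp
  also have "\<dots> = (\<Sum>I | I \<in> Pow U \<and> \<sigma> I - \<alpha> \<in> \<int>. A I * F I * of_nat N)"
    using U by (subst sum.inter_filter) auto
  also have "\<dots> = (\<Sum>I | I \<subseteq> U \<and> \<sigma> I - \<alpha> \<in> \<int>. A I * F I) * of_nat N"
    by (simp add: sum_distrib_right)
  finally show ?thesis using \<open>N > 0\<close> by (simp add: A_def)
qed

text \<open>Writing \<open>f I\<close> as \<open>u * of_bool (I \<in> K) + p * b I\<close> turns the
  vanishing sum into \<open>u * X = - p * Y\<close>. A Bezout relation between \<open>u\<close> and
  \<open>p\<close> then exhibits \<open>X\<close> as a multiple of \<open>p\<close> inside the
  ring.\<close>

lemma cyclotomic_sum_mod_prime: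
  fixes \<zeta> :: "'i \<Rightarrow> complex" and f :: "'i \<Rightarrow> int"
  assumes p: "prime p" and J: "finite J" "K \<subseteq> J" and u: "\<not> int p dvd u"
    and \<zeta>: "\<And>I. I \<in> J \<Longrightarrow> \<zeta> I \<in> cyclotomic_integers N"
    and sum0: "(\<Sum>I\<in>J. \<zeta> I * of_int (f I)) = 0"
    and f: "\<And>I. I \<in> J \<Longrightarrow> int p dvd f I - u * of_bool (I \<in> K)"
  shows "\<exists>w\<in>cyclotomic_integers N. (\<Sum>I\<in>K. \<zeta> I) = of_nat p * w"
proof -
  have "\<exists>b. f I - u * of_bool (I \<in> K) = int p * b" if "I \<in> J" for I
    using f[OF that] by blast
  then obtain b where b: "\<And>I. I \<in> J \<Longrightarrow> f I = u * of_bool (I \<in> K) + int p * b I"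
    by (metis diff_add_cancel add.commute)
  define X where "X = (\<Sum>I\<in>K. \<zeta> I)"
  define Y where "Y = (\<Sum>I\<in>J. \<zeta> I * of_int (b I))"
  have "0 = (\<Sum>I\<in>J. \<zeta> I * of_int (u * of_bool (I \<in> K) + int p * b I))"
    using sum0 b by simp
  also have "\<dots> = of_int u * (\<Sum>I\<in>J. if I \<in> K then \<zeta> I else 0) + of_nat p * Y"
    unfolding Y_def sum_distrib_left sum.distrib[symmetric]
    by (intro sum.cong) (auto simp: algebra_simps)
  also have "(\<Sum>I\<in>J. if I \<in> K then \<zeta> I else 0) = X"
    unfolding X_def using J by (simp add: sum.inter_restrict[symmetric] Int_absorb1)
  finally have uX: "of_int u * X = - (of_nat p * Y)" by (simp add: eq_neg_iff_add_eq_0)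
  have "coprime u (int p)" using p u by (simp add: coprime_commute[of u] prime_imp_coprime)
  then obtain v t where vt: "v * u + t * int p = 1" by (metis bezout_int coprime_imp_gcd_eq_1)
  have "X = of_int (v * u + t * int p) * X" by (simp add: vt)
  also have "\<dots> = of_int v * (of_int u * X) + of_nat p * (of_int t * X)" by (simp add: algebra_simps)
  also have "\<dots> = of_nat p * (of_int (- v) * Y + of_int t * X)"
    unfolding uX by (simp add: algebra_simps)
  finally have "X = of_nat p * (of_int (- v) * Y + of_int t * X)" .
  moreover have "of_int (- v) * Y + of_int t * X \<in> cyclotomic_integers N"
    unfolding X_def Y_def
    by (intro cyclotomic_integers_add cyclotomic_integers_mult cyclotomic_integers_sum
        cyclotomic_integers_of_int \<zeta>) (use J in auto)
  ultimately show ?thesis unfolding X_def by blast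
qed

text \<open>Otherwise multiplication by the inverse of the left side would make \<open>1/p\<close>
  an algebraic integer, and a rational algebraic integer is an integer. This rules out a sum with a
  single term.\<close>

lemma prime_not_dvd_unit_exp:
  assumes "prime p" "N > 0" "of_nat N * x \<in> \<int>" "w \<in> cyclotomic_integers N"
  shows "(-1) ^ j * unit_exp x \<noteq> of_nat p * w"
proof
  assume eq: "(-1) ^ j * unit_exp x = of_nat p * w"
  have "of_nat N * (- x) = - (of_nat N * x)" by simp
  then have "of_nat N * (- x) \<in> \<int>" using assms(3) by (simp only: Ints_minus)
  then have "unit_exp (- x) \<in> cyclotomic_integers N" using assms(2) by (rule unit_exp_in_cyclotomic_integers[rotated])
  then have "of_int ((-1) ^ j) * unit_exp (- x) * w \<in> cyclotomic_integers N" (is "?y \<in> _")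
    using assms(4) by blast
  then have alg: "algebraic_int ?y" by (rule algebraic_int_cyclotomic_integers[OF assms(2)])
  have p0: "(of_nat p :: complex) \<noteq> 0" using prime_gt_0_nat[OF assms(1)] by simp
  have "of_nat p * ?y = (-1) ^ j * unit_exp (- x) * (of_nat p * w)" by simp
  also have "\<dots> = ((-1) ^ j * (-1) ^ j) * (unit_exp (- x) * unit_exp x)" unfolding eq[symmetric] by (simp only: mult_ac)
  also have "\<dots> = 1" by (simp flip: unit_exp_add power_mult_distrib)
  finally have y: "of_nat p * ?y = 1" .
  then have "?y = 1 / of_nat p" using p0 by (simp add: field_simps)
  then have "?y \<in> \<rat>" by simp
  with alg have "?y \<in> \<int>" by (rule rational_algebraic_int_is_int)
  then obtain z where "?y = of_int z" by (auto elim: Ints_cases)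
  with y have "(of_int (int p * z) :: complex) = of_int 1" by simp
  then have "int p * z = 1" by (simp only: of_int_eq_iff)
  then show False using prime_gt_1_nat[OF assms(1)] by (auto simp: zmult_eq_1_iff)
qed

lemma is_m_cover_card:
  assumes "is_m_cover M k a n"
  shows "M \<le> card {s \<in> {1..k}. int (n s) dvd a s - x}"
proof -
  have iff: "x \<in> residue_class (a s) (n s) \<longleftrightarrow> int (n s) dvd a s - x" for s
    by (subst dvd_diff_commute) (auto simp: residue_class_def dvd_def algebra_simps)
  have "M \<le> cover_mult k a n x" using assms by (simp add: is_m_cover_def)
  then show ?thesis by (simp only: cover_mult_def iff)
qed

section \<open>Few residues force divisibility of the weighted sum by p\<close>

theorem theorem3p1:
  fixes p h \<Delta> k d :: nat
    and G :: "('g, 'b) monoid_scheme"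
    and a m :: "nat \<Rightarrow> int" and n :: "nat \<Rightarrow> nat"
    and c :: 'g and cs :: "nat \<Rightarrow> 'g"
    and \<alpha> :: rat
    and P :: "rat mvpoly"
    and II :: "nat set set"
  assumes "prime p"
    and "comm_group G" and "finite (carrier G)" and "is_p_group p G"
    and "\<forall>s \<in> {1..k}. n s > 0"
    and "is_m_cover (dstar G + p ^ h + \<Delta>) k a n"
    and "c \<in> carrier G" and "\<forall>s \<in> {1..k}. cs s \<in> carrier G"
    and II_def: "II = {I. I \<subseteq> {1..k} \<and> finprod G cs I = c \<and>
      (\<exists>z::int. (\<Sum>s\<in>I. of_int (m s) / of_nat (n s)) = \<alpha> + of_nat (p ^ h) * of_int z)}"
    and "d > 0"
    and "mv_vars P \<subseteq> {1..k}" and "mv_degree P \<le> d"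
    and "\<forall>I \<subseteq> {1..k}. (\<Sum>s\<in>I. of_int (m s) / of_nat (n s)) - \<alpha> \<in> \<int> \<longrightarrow> eval_at_set P I \<in> \<int>"
  shows "real (card ((\<lambda>I. \<lfloor>eval_at_set P I\<rfloor> mod int p) ` II)) > 1 + real \<Delta> / real d
    \<or> (card {I \<in> II. int p dvd \<lfloor>eval_at_set P I\<rfloor>} \<noteq> 1 \<and>
       alg_int_cong
         (\<Sum>I \<in> {I \<in> II. int p dvd \<lfloor>eval_at_set P I\<rfloor>}.
            (-1) ^ card I *
            exp (2 * of_real pi * \<i> * (\<Sum>s\<in>I. of_int (a s * m s) / of_nat (n s))))
         0 (of_nat p))"
proof -
  define \<sigma> :: "nat set \<Rightarrow> rat" where "\<sigma> I = (\<Sum>s\<in>I. of_int (m s) / of_nat (n s))" for I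
  define A where "A I = (\<Sum>s\<in>I. of_int (a s * m s) / of_nat (n s) :: rat)" for I
  define v where "v I = \<lfloor>eval_at_set P I\<rfloor>" for I
  define J where "J = {I. I \<subseteq> {1..k} \<and> \<sigma> I - \<alpha> \<in> \<int>}"
  define K where "K = {I \<in> II. int p dvd v I}"
  note p = \<open>prime p\<close>
  have p_pos: "0 < p ^ j" for j using prime_gt_0_nat[OF p] by simp
  have II_iff: "I \<in> II \<longleftrightarrow> I \<subseteq> {1..k} \<and> finprod G cs I = c \<and> (\<exists>z. \<sigma> I = \<alpha> + of_nat (p ^ h) * of_int z)" for I
    by (simp add: II_def \<sigma>_def)
  have "II \<subseteq> J"
  proof
    fix I assume "I \<in> II"
    then have "I \<subseteq> {1..k}" "\<exists>z. \<sigma> I = \<alpha> + of_nat (p ^ h) * of_int z" by (simp_all only: II_iff)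
    then show "I \<in> J" by (auto simp only: J_def mem_Collect_eq add_diff_cancel_left' intro!: Ints_mult Ints_of_nat Ints_of_int)
  qed
  then have KJ: "K \<subseteq> J" by (auto simp: K_def)
  have finJ: "finite J" by (rule finite_subset[of _ "Pow {1..k}"]) (auto simp: J_def)
  have v: "eval_at_set P I = of_int (v I)" if "I \<in> J" for I
    using that assms(13) by (auto simp: J_def \<sigma>_def v_def elim: Ints_cases)
  define N where "N = (\<Prod>s\<in>{1..k}. n s)"
  have N: "N > 0" using assms(5) by (auto simp: N_def intro!: prod_pos)
  have NA: "of_nat N * A I \<in> \<int>" if "I \<subseteq> {1..k}" for I
    unfolding A_def sum_distrib_left
  proof (rule Ints_sum)
    fix s assume "s \<in> I"
    then have s: "s \<in> {1..k}" using that by auto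
    then have "n s dvd N" unfolding N_def by (intro dvd_prodI) auto
    then obtain l where "N = n s * l" by blast
    then show "of_nat N * (of_int (a s * m s) / of_nat (n s)) \<in> (\<int> :: rat set)"
      using assms(5) s by (simp add: Ints_mult)
  qed
  define \<zeta> where "\<zeta> I = (-1) ^ card I * unit_exp (A I)" for I :: "nat set"
  have \<zeta>: "\<zeta> I \<in> cyclotomic_integers N" if "I \<in> J" for I
  proof -
    have "of_int ((-1) ^ card I) * unit_exp (A I) \<in> cyclotomic_integers N"
      by (intro cyclotomic_integers_mult cyclotomic_integers_of_int unit_exp_in_cyclotomic_integers N NA)
        (use that in \<open>simp add: J_def\<close>)
    then show ?thesis by (simp add: \<zeta>_def)
  qed
  have goal_sum: "(\<Sum>I \<in> {I \<in> II. int p dvd \<lfloor>eval_at_set P I\<rfloor>}.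
            (-1) ^ card I *
            exp (2 * of_real pi * \<i> * (\<Sum>s\<in>I. of_int (a s * m s) / of_nat (n s)))) = (\<Sum>I\<in>K. \<zeta> I)"
    by (simp add: K_def v_def \<zeta>_def A_def unit_exp_def of_rat_sum of_rat_divide of_rat_mult)
  have K_eq: "{I \<in> II. int p dvd \<lfloor>eval_at_set P I\<rfloor>} = K" by (simp add: K_def v_def)
  show ?thesis
  proof (cases "real (card ((\<lambda>I. v I mod int p) ` II)) > 1 + real \<Delta> / real d \<or> K = {}")
    case True
    then show ?thesis
    proof
      assume "K = {}"
      then have "card K \<noteq> 1" "(\<Sum>I\<in>K. \<zeta> I) = 0" by simp_all
      then show ?thesis unfolding goal_sum unfolding K_eq
        by (auto simp: alg_int_cong_def intro!: exI[of _ 0])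
    qed (simp add: v_def)
  next
    case False
    \<comment> \<open>As \<open>K\<close> is nonempty, the residue 0 occurs. Leaving it out accounts
      for the 1 in the bound, so that \<open>card R * d \<le> \<Delta>\<close>.\<close>
    define R where "R = (\<lambda>I. v I mod int p) ` II - {0}"
    have finR: "finite R" unfolding R_def using finite_subset[OF \<open>II \<subseteq> J\<close> finJ] by simp
    have "0 \<in> (\<lambda>I. v I mod int p) ` II" using False by (force simp: K_def)
    then have "card ((\<lambda>I. v I mod int p) ` II) = Suc (card R)"
      unfolding R_def using finite_subset[OF \<open>II \<subseteq> J\<close> finJ] by (intro card.remove) auto
    with False have "real (card R) \<le> real \<Delta> / real d" by simp
    then have "real (card R * d) \<le> real \<Delta>" using \<open>d > 0\<close> by (simp add: field_simps)
    then have cardR: "card R * d \<le> \<Delta>" by (simp only: of_nat_le_iff)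
    obtain r t and \<psi> :: "'g \<Rightarrow> nat \<Rightarrow> int" where
      dstar: "dstar G = (\<Sum>i<r. p ^ t i - 1)" and
      coord: "\<forall>(I :: nat set) cs c. finite I \<longrightarrow> cs \<in> I \<rightarrow> carrier G \<longrightarrow> c \<in> carrier G \<longrightarrow>
        finprod G cs I = c \<longleftrightarrow> (\<forall>i<r. int (p ^ t i) dvd (\<Sum>s\<in>I. \<psi> (cs s) i) - \<psi> c i)"
      using p_group_coordinates[OF assms(2,3,1,4)] by blast
    define C where "C i I = (\<Sum>s\<in>{1..k} \<inter> I. \<psi> (cs s) i) - \<psi> c i" for i I
    have coord_C: "finprod G cs I = c \<longleftrightarrow> (\<forall>i<r. int (p ^ t i) dvd C i I)" if "I \<subseteq> {1..k}" for I
    proof -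
      have "{1..k} \<inter> I = I" "finite I" using that by (auto dest: finite_subset)
      moreover have "cs \<in> I \<rightarrow> carrier G" using that assms(8) by auto
      ultimately show ?thesis using coord assms(7) by (simp add: C_def)
    qed
    \<comment> \<open>The factors test in turn the condition on \<open>\<sigma> I\<close>, the group
      condition and \<open>p dvd v I\<close>. The shifts by -1 produce the argument
      \<open>x - 1\<close> of the binomial indicators. Intersecting with \<open>{1..k}\<close> makes
      \<open>f\<close> a polynomial function on all sets.\<close>
    define f :: "nat set \<Rightarrow> rat" where
      "f I = (((\<Sum>s\<in>{1..k} \<inter> I. of_int (m s) / of_nat (n s)) + (- \<alpha> - 1)) gchoose (p ^ h - 1)) *
        (\<Prod>i<r. ((\<Sum>s\<in>{1..k} \<inter> I. of_int (\<psi> (cs s) i)) + (- of_int (\<psi> c i) - 1)) gchoose (p ^ t i - 1)) *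
        (\<Prod>\<rho>\<in>R. eval_at_set P I + - of_int \<rho>)" for I
    have "set_poly d (eval_at_set P)"
      using set_poly_mono[OF set_poly_eval_at_set assms(12)] .
    then have "set_poly (p ^ h - 1 + (\<Sum>i<r. p ^ t i - 1) + (\<Sum>\<rho>\<in>R. d)) f"
      unfolding f_def
      by (intro set_poly_mult set_poly_gchoose set_poly_linear set_poly_prod set_poly.add set_poly_const) auto
    then have "set_poly (p ^ h - 1 + dstar G + \<Delta>) f"
      by (rule set_poly_mono) (use cardR dstar in simp)
    then have f_poly: "set_poly (p ^ h - 1 + dstar G + \<Delta>) (\<lambda>I. of_rat (f I) :: complex)"
      by (rule set_poly_of_rat)
    define z where "z I = \<lfloor>\<sigma> I - \<alpha>\<rfloor>" for I
    have z: "\<sigma> I = \<alpha> + of_int (z I)" if "I \<in> J" for I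
      using that by (auto simp: J_def z_def elim!: Ints_cases)
    \<comment> \<open>The integer form of \<open>f\<close>, equal to it only on \<open>J\<close>,
      where \<open>\<sigma> I - \<alpha>\<close> and the value of \<open>P\<close> are
      integral.\<close>
    define fi where "fi I = int_choose (z I - 1) (p ^ h - 1) *
      (\<Prod>i<r. int_choose (C i I - 1) (p ^ t i - 1)) * (\<Prod>\<rho>\<in>R. v I - \<rho>)" for I
    have f_fi: "f I = of_int (fi I)" if "I \<in> J" for I
    proof -
      have "{1..k} \<inter> I = I" using that by (auto simp: J_def)
      then show ?thesis using z[OF that] v[OF that]
        by (simp add: f_def fi_def of_int_int_choose \<sigma>_def[symmetric] C_def algebra_simps)
    qed
    \<comment> \<open>The common value modulo \<open>p\<close> of \<open>fi\<close> on
      \<open>K\<close>, where \<open>v I\<close> vanishes; it is a unit because \<open>R\<close>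
      consists of nonzero residues.\<close>
    define u where "u = (-1) ^ (p ^ h - 1) * (\<Prod>i<r. (-1) ^ (p ^ t i - 1)) * (\<Prod>\<rho>\<in>R. - \<rho>)"
    have ip: "prime (int p)" using p by simp
    have "\<not> int p dvd \<rho>" if "\<rho> \<in> R" for \<rho>
    proof -
      have "\<rho> \<noteq> 0" "\<rho> mod int p = \<rho>" using that by (auto simp: R_def)
      then show ?thesis by (metis dvd_imp_mod_0)
    qed
    moreover have "\<not> int p dvd 1" using ip not_prime_unit by blast
    moreover have "\<not> int p dvd (-1) ^ j" for j
      using \<open>\<not> int p dvd 1\<close> prime_dvd_power[OF ip, of "-1" j] by auto
    ultimately have u: "\<not> int p dvd u"
      unfolding u_def using finR by (auto simp: prime_dvd_mult_iff[OF ip] prime_dvd_prod_iff[OF _ ip])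
    have cong_f: "[fi I = u * of_bool (I \<in> K)] (mod int p)" if I: "I \<in> J" for I
    proof -
      have IU: "I \<subseteq> {1..k}" using I by (simp add: J_def)
      have choose: "[int_choose (x - 1) (p ^ j - 1) = of_bool (int (p ^ j) dvd x) * (-1) ^ (p ^ j - 1)] (mod int p)"
        for x j using int_choose_prime_power_cong[OF p] by (simp add: cong_iff_dvd_diff)
      have "[fi I = (of_bool (int (p ^ h) dvd z I) * (-1) ^ (p ^ h - 1)) *
          (\<Prod>i<r. of_bool (int (p ^ t i) dvd C i I) * (-1) ^ (p ^ t i - 1)) * (\<Prod>\<rho>\<in>R. v I mod int p - \<rho>)] (mod int p)"
        unfolding fi_def by (intro cong_mult cong_prod choose cong_diff) (auto simp: cong_def)
      also have "(of_bool (int (p ^ h) dvd z I) * (-1) ^ (p ^ h - 1)) *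
          (\<Prod>i<r. of_bool (int (p ^ t i) dvd C i I) * (-1) ^ (p ^ t i - 1)) * (\<Prod>\<rho>\<in>R. v I mod int p - \<rho>)
          = u * of_bool (I \<in> K)"
      proof (cases "I \<in> II")
        case True
        then obtain z' where "\<sigma> I = \<alpha> + of_nat (p ^ h) * of_int z'" by (auto simp: II_iff)
        with z[OF I] have "(of_int (z I) :: rat) = of_int (int (p ^ h) * z')" by simp
        then have "int (p ^ h) dvd z I" by (simp only: of_int_eq_iff) simp
        moreover have "int (p ^ t i) dvd C i I" if "i < r" for i
          using True coord_C[OF IU] that by (auto simp: II_iff)
        moreover have "(\<Prod>\<rho>\<in>R. v I mod int p - \<rho>) = of_bool (I \<in> K) * (\<Prod>\<rho>\<in>R. - \<rho>)"
        proof (cases "I \<in> K")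
          case True
          then have "v I mod int p = 0" by (simp add: K_def)
          then show ?thesis using True by simp
        next
          case False
          then have "v I mod int p \<in> R" using \<open>I \<in> II\<close> by (auto simp: K_def R_def dvd_eq_mod_eq_0)
          then show ?thesis using False finR by (auto intro: prod_zero)
        qed
        ultimately show ?thesis by (simp add: u_def mult_ac)
      next
        case False
        \<comment> \<open>Members of \<open>J\<close> already have integral
          \<open>\<sigma> I - \<alpha>\<close>, so leaving \<open>II\<close> means that one of the
          tested divisibilities fails.\<close>
        then have "\<not> int (p ^ h) dvd z I \<or> (\<exists>i<r. \<not> int (p ^ t i) dvd C i I)"
          using z[OF I] coord_C[OF IU] IU by (auto simp: II_iff elim!: dvdE)
        then have "of_bool (int (p ^ h) dvd z I) * (\<Prod>i<r. of_bool (int (p ^ t i) dvd C i I)) = (0 :: int)"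
          by (auto intro!: prod_zero)
        moreover have "I \<notin> K" using False by (simp add: K_def)
        ultimately show ?thesis by (auto simp: prod.distrib)
      qed
      finally show ?thesis .
    qed
    \<comment> \<open>The indicator for \<open>p ^ h\<close> has degree \<open>p ^ h - 1\<close>,
      which provides the strict inequality.\<close>
    have deg: "p ^ h - 1 + dstar G + \<Delta> < card {s \<in> {1..k}. int (n s) dvd a s - x}" for x
      using is_m_cover_card[OF assms(6), of x] p_pos[of h] by linarith
    have "(\<Sum>I\<in>J. \<zeta> I * of_rat (f I)) = 0"
      unfolding J_def \<sigma>_def \<zeta>_def A_def
      by (rule cover_weighted_sum_eq_0[OF _ _ f_poly deg]) (use assms(5) in auto)
    then have "(\<Sum>I\<in>J. \<zeta> I * of_int (fi I)) = 0" using f_fi by simp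
    from cyclotomic_sum_mod_prime[OF p finJ KJ u \<zeta> this] cong_f
    obtain w where w: "w \<in> cyclotomic_integers N" "(\<Sum>I\<in>K. \<zeta> I) = of_nat p * w"
      by (auto simp: cong_iff_dvd_diff)
    have "card K \<noteq> 1"
    proof
      assume "card K = 1"
      then obtain I where I: "K = {I}" by (rule card_1_singletonE)
      then have "I \<subseteq> {1..k}" using KJ by (auto simp: J_def)
      then show False
        using prime_not_dvd_unit_exp[OF p N NA w(1), of I "card I"] w(2) I by (simp add: \<zeta>_def)
    qed
    moreover have "algebraic_int w" by (rule algebraic_int_cyclotomic_integers[OF N w(1)])
    ultimately show ?thesis
      unfolding goal_sum unfolding K_eq using w(2) by (auto simp: alg_int_cong_def)
  qed
qed

end
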